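(* Let $\chi_1$ and $\chi_2$ be two independent and identically distributed functional random variables in $L^{2}(T)$ with mean function $\mu_{\chi}$ and compact covariance operator $\Gamma_{\chi}$, and let $K$ be a positive integer with $\lambda_K>0$. The functional Mahalanobis semi-distance between $\chi_1$ and $\chi_2$ can be written as $$d_{FM}^{K}(\chi_1,\chi_2)=\left(\sum_{k=1}^{K}(\omega_{1k}-\omega_{2k})^{2}\right)^{1/2},$$ where $\omega_{1k}=\theta_{1k}/\lambda_{k}^{1/2}$ and $\omega_{2k}=\theta_{2k}/\lambda_k^{1/2}$ are the standardized functional principal component scores of $\chi_1$ and $\chi_2$, respectively.
   Context: $T=[a,b]$ is a closed interval of the real line and $L^{2}(T)$ is the real Hilbert space of square integrable functions on $T$, with inner product $\langle f,g\rangle=\int_T f(t)g(t)\,dt$ and norm $\|\cdot\|_2$. A functional random variable $\chi$ is a random element of $L^2(T)$; it is assumed throughout that $E[\|\chi\|_2^4]<\infty$. Its mean function is $\mu_\chi(t)=E[\chi(t)]$ and its covariance operator is $\Gamma_\chi(\eta)=E[\langle \chi-\mu_\chi,\eta\rangle(\chi-\mu_\chi)]$ for $\eta\in L^2(T)$, which is compact. Here $\mu_\chi$ and $\Gamma_\chi$ are the common mean function and covariance operator of $\chi_1$ and $\chi_2$. Let $\lambda_1\ge\lambda_2\ge\cdots\ge 0$ be the eigenvalues of $\Gamma_\chi$ ($\sum_k\lambda_k<\infty$), and let $\psi_1,\psi_2,\ldots$ be a fixed associated sequence of orthonormal eigenfunctions, $\Gamma_\chi(\psi_k)=\lambda_k\psi_k$,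 forming an orthonormal basis of $L^2(T)$. The functional principal component scores of $\chi_i$ ($i=1,2$) are $\theta_{ik}=\langle\chi_i-\mu_\chi,\psi_k\rangle$, $k=1,2,\ldots$ For functions $f,g$, $(f\otimes f)(g)=\langle f,g\rangle f$. For a positive integer $K$ with $\lambda_K>0$, the regularized square root inverse operator is $$\Gamma_K^{-1/2}(\zeta)=\sum_{k=1}^K\frac{1}{\lambda_k^{1/2}}(\psi_k\otimes\psi_k)(\zeta)=\sum_{k=1}^K\frac{\langle\psi_k,\zeta\rangle}{\lambda_k^{1/2}}\psi_k .$$ The functional Mahalanobis semi-distance between $\chi_1$ and $\chi_2$ is $$d_{FM}^K(\chi_1,\chi_2)=\left\langle\Gamma_K^{-1/2}(\chi_1-\chi_2),\Gamma_K^{-1/2}(\chi_1-\chi_2)\right\rangle^{1/2}.$$ *)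

theory Defs
  imports "HOL-Probability.Probability"
begin

section \<open>The Hilbert space of square integrable functions\<close>

definition square_integrable :: "(real \<Rightarrow> real) \<Rightarrow> bool" where
  "square_integrable f \<longleftrightarrow> f \<in> borel_measurable lebesgue \<and> integrable lebesgue (\<lambda>t. (f t)\<^sup>2)"

lemma square_integrable_mult:
  assumes "square_integrable f" "square_integrable g"
  shows "integrable lebesgue (\<lambda>t. f t * g t)"
proof (rule Bochner_Integration.integrable_bound)
  show "integrable lebesgue (\<lambda>t. (f t)\<^sup>2 + (g t)\<^sup>2)"
    using assms by (auto simp: square_integrable_def)
  show "(\<lambda>t. f t * g t) \<in> borel_measurable lebesgue"
    using assms by (auto simp: square_integrable_def)
  have "norm (x * y) \<le> norm (x\<^sup>2 + y\<^sup>2)" for x y :: real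
  proof -
    have "0 \<le> (\<bar>x\<bar> - \<bar>y\<bar>)\<^sup>2" by simp
    then have "2 * (\<bar>x\<bar> * \<bar>y\<bar>) \<le> x\<^sup>2 + y\<^sup>2" by (simp add: power2_diff)
    moreover have "0 \<le> \<bar>x\<bar> * \<bar>y\<bar>" by simp
    ultimately have "\<bar>x\<bar> * \<bar>y\<bar> \<le> x\<^sup>2 + y\<^sup>2" by linarith
    then show ?thesis by (simp add: abs_mult)
  qed
  then show "AE t in lebesgue. norm (f t * g t) \<le> norm ((f t)\<^sup>2 + (g t)\<^sup>2)"
    by auto
qed

lemma square_integrable_zero: "square_integrable (\<lambda>t. 0)"
  by (simp add: square_integrable_def)

lemma square_integrable_scale: "square_integrable f \<Longrightarrow> square_integrable (\<lambda>t. c * f t)"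
  by (auto simp: square_integrable_def power_mult_distrib)

lemma square_integrable_add:
  assumes "square_integrable f" "square_integrable g"
  shows "square_integrable (\<lambda>t. f t + g t)"
proof -
  have "integrable lebesgue (\<lambda>t. (f t)\<^sup>2 + (g t)\<^sup>2 + 2 * (f t * g t))"
    using assms square_integrable_mult[OF assms] by (auto simp: square_integrable_def)
  then show ?thesis
    using assms by (auto simp: square_integrable_def power2_sum algebra_simps)
qed

lemma square_integrable_diff:
  assumes "square_integrable f" "square_integrable g"
  shows "square_integrable (\<lambda>t. f t - g t)"
  using square_integrable_add[OF assms(1) square_integrable_scale[OF assms(2), of "-1"]] by simp

text \<open>
  A type cannot depend on an interval \<open>T\<close>, so \<open>L2\<close> consists of the classes, modulo equality almost
  everywhere, of the square integrable functions on the whole line. The space of square integrable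
  functions on \<open>T\<close> is the subspace \<open>L2_on T\<close> defined below, of the functions vanishing off \<open>T\<close>; on it
  the inner product is the integral over \<open>T\<close> (lemma \<open>inner_L2_on\<close>). The type is shown to be a
  separable Hilbert space, which makes Borel sets and Bochner integrals available for it.
\<close>

quotient_type L2 = "real \<Rightarrow> real" / partial:
  "\<lambda>f g. square_integrable f \<and> square_integrable g \<and> (AE t in lebesgue. f t = g t)"
  morphisms rep_L2 abs_L2
proof (rule part_equivpI)
  show "\<exists>f. square_integrable f \<and> square_integrable f \<and> (AE t in lebesgue. f t = f t)"
    using square_integrable_zero by auto
  show "symp (\<lambda>f g. square_integrable f \<and> square_integrable g \<and> (AE t in lebesgue. f t = g t))"
    by (auto simp: symp_def elim: eventually_mono)
  show "transp (\<lambda>f g. square_integrable f \<and> square_integrable g \<and> (AE t in lebesgue. f t = g t))"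
    by (rule transpI) (auto elim: eventually_elim2)
qed

instantiation L2 :: real_vector
begin

lift_definition zero_L2 :: L2 is "\<lambda>t. 0"
  by (simp add: square_integrable_zero)

lift_definition plus_L2 :: "L2 \<Rightarrow> L2 \<Rightarrow> L2" is "\<lambda>f g t. f t + g t"
  by (auto intro: square_integrable_add elim: eventually_elim2)

lift_definition minus_L2 :: "L2 \<Rightarrow> L2 \<Rightarrow> L2" is "\<lambda>f g t. f t - g t"
  by (auto intro: square_integrable_diff elim: eventually_elim2)

lift_definition uminus_L2 :: "L2 \<Rightarrow> L2" is "\<lambda>f t. - f t"
  using square_integrable_scale[where c = "-1"] by (auto elim: eventually_mono)

lift_definition scaleR_L2 :: "real \<Rightarrow> L2 \<Rightarrow> L2" is "\<lambda>c f t. c * f t"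
  by (auto intro: square_integrable_scale elim: eventually_mono)

instance
proof
qed (transfer; auto simp: algebra_simps intro!: square_integrable_add square_integrable_diff
      square_integrable_scale square_integrable_zero square_integrable_scale[where c = "-1", simplified])+

end

instantiation L2 :: real_inner
begin

lift_definition inner_L2 :: "L2 \<Rightarrow> L2 \<Rightarrow> real" is "\<lambda>f g. \<integral>t. f t * g t \<partial>lebesgue"
  by (intro integral_cong_AE) (auto simp: square_integrable_def)

definition norm_L2 :: "L2 \<Rightarrow> real" where "norm_L2 f = sqrt (inner f f)"
definition dist_L2 :: "L2 \<Rightarrow> L2 \<Rightarrow> real" where "dist_L2 f g = norm (f - g)"
definition sgn_L2 :: "L2 \<Rightarrow> L2" where "sgn_L2 f = f /\<^sub>R norm f"
definition uniformity_L2 :: "(L2 \<times> L2) filter" where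
  "uniformity_L2 = (INF e\<in>{0<..}. principal {(x, y). dist x y < e})"
definition open_L2 :: "L2 set \<Rightarrow> bool" where
  "open_L2 U \<longleftrightarrow> (\<forall>x\<in>U. \<forall>\<^sub>F (x', y) in uniformity. x' = x \<longrightarrow> y \<in> U)"

instance
proof
  fix x y z :: L2 and r :: real
  show "inner x y = inner y x"
    by transfer (simp add: mult.commute)
  show "inner (x + y) z = inner x z + inner y z"
    by transfer (auto simp: distrib_right square_integrable_mult)
  show "inner (r *\<^sub>R x) y = r * inner x y"
    by transfer (simp add: mult.assoc)
  show "0 \<le> inner x x"
    by transfer simp
  show "inner x x = 0 \<longleftrightarrow> x = 0"
  proof transfer
    fix f :: "real \<Rightarrow> real"
    assume "square_integrable f \<and> square_integrable f \<and> (AE t in lebesgue. f t = f t)"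
    then have f: "square_integrable f" by simp
    have "(\<integral>t. f t * f t \<partial>lebesgue) = 0 \<longleftrightarrow> (AE t in lebesgue. f t * f t = 0)"
      by (rule integral_nonneg_eq_0_iff_AE) (auto intro: square_integrable_mult[OF f f])
    then show "(\<integral>t. f t * f t \<partial>lebesgue) = 0 \<longleftrightarrow>
        square_integrable f \<and> square_integrable (\<lambda>t. 0) \<and> (AE t in lebesgue. f t = 0)"
      using f square_integrable_zero by simp
  qed
qed (simp_all add: norm_L2_def dist_L2_def sgn_L2_def uniformity_L2_def open_L2_def)

end

lemma square_integrable_rep: "square_integrable (rep_L2 x)"
  using Quotient3_rep_reflp[OF Quotient3_L2, of x] by simp

lemma abs_rep_L2: "abs_L2 (rep_L2 x) = x"
  by (rule Quotient3_abs_rep[OF Quotient3_L2])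

lemma abs_L2_cong:
  "square_integrable f \<Longrightarrow> square_integrable g \<Longrightarrow> AE t in lebesgue. f t = g t \<Longrightarrow> abs_L2 f = abs_L2 g"
  using Quotient3_rel_abs[OF Quotient3_L2] by blast

lemma abs_L2_cases: obtains f where "square_integrable f" "x = abs_L2 f"
  using square_integrable_rep abs_rep_L2 by metis

lemma norm_abs_L2:
  assumes "square_integrable f"
  shows "norm (abs_L2 f) = sqrt (\<integral>t. (f t)\<^sup>2 \<partial>lebesgue)"
  using assms by (simp add: norm_L2_def inner_L2.abs_eq power2_eq_square)

lemma abs_L2_diff:
  "square_integrable f \<Longrightarrow> square_integrable g \<Longrightarrow> abs_L2 f - abs_L2 g = abs_L2 (\<lambda>t. f t - g t)"
  by (simp add: minus_L2.abs_eq)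

lemma abs_L2_add:
  "square_integrable f \<Longrightarrow> square_integrable g \<Longrightarrow> abs_L2 f + abs_L2 g = abs_L2 (\<lambda>t. f t + g t)"
  by (simp add: plus_L2.abs_eq)

lemma abs_L2_scale:
  "square_integrable f \<Longrightarrow> c *\<^sub>R abs_L2 f = abs_L2 (\<lambda>t. c * f t)"
  by (simp add: scaleR_L2.abs_eq)

lemma square_integrable_sum:
  "(\<And>i. i \<in> I \<Longrightarrow> square_integrable (f i)) \<Longrightarrow> square_integrable (\<lambda>t. \<Sum>i\<in>I. f i t)"
  by (induction I rule: infinite_finite_induct)
     (auto intro: square_integrable_zero square_integrable_add)

lemma abs_L2_sum:
  "(\<And>i. i \<in> I \<Longrightarrow> square_integrable (f i)) \<Longrightarrow>
    (\<Sum>i\<in>I. abs_L2 (f i)) = abs_L2 (\<lambda>t. \<Sum>i\<in>I. f i t)"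
  by (induction I rule: infinite_finite_induct)
     (auto simp: zero_L2_def abs_L2_add square_integrable_sum)

lemma square_integrable_abs: "square_integrable f \<Longrightarrow> square_integrable (\<lambda>t. \<bar>f t\<bar>)"
  by (auto simp: square_integrable_def)

lemma square_integrable_bound:
  assumes "square_integrable w" "f \<in> borel_measurable lebesgue" "AE t in lebesgue. \<bar>f t\<bar> \<le> w t"
  shows "square_integrable f"
  unfolding square_integrable_def
proof (intro conjI)
  show "integrable lebesgue (\<lambda>t. (f t)\<^sup>2)"
  proof (rule Bochner_Integration.integrable_bound)
    show "integrable lebesgue (\<lambda>t. (w t)\<^sup>2)"
      using assms by (simp add: square_integrable_def)
    show "AE t in lebesgue. norm ((f t)\<^sup>2) \<le> norm ((w t)\<^sup>2)"
      using assms(3) by eventually_elim (simp add: abs_le_square_iff[symmetric])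
  qed (use assms in simp)
qed fact

lemma abs_L2_dominated_convergence:
  assumes w: "square_integrable w" and f: "f \<in> borel_measurable lebesgue"
    and s: "\<And>n. s n \<in> borel_measurable lebesgue"
    and lim: "AE t in lebesgue. (\<lambda>n. s n t) \<longlonglongrightarrow> f t"
    and bound: "\<And>n. AE t in lebesgue. \<bar>s n t\<bar> \<le> w t"
  shows "square_integrable f" "(\<lambda>n. abs_L2 (s n)) \<longlonglongrightarrow> abs_L2 f"
proof -
  have all: "AE t in lebesgue. \<forall>n. \<bar>s n t\<bar> \<le> w t"
    using bound by (simp add: AE_all_countable)
  have fw: "AE t in lebesgue. \<bar>f t\<bar> \<le> w t"
    using lim all
  proof eventually_elim
    fix t assume lim_t: "(\<lambda>n. s n t) \<longlonglongrightarrow> f t" and "\<forall>n. \<bar>s n t\<bar> \<le> w t"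
    then show "\<bar>f t\<bar> \<le> w t"
      using LIMSEQ_le_const2[OF tendsto_rabs[OF lim_t]] by blast
  qed
  show sf: "square_integrable f"
    by (rule square_integrable_bound[OF w f fw])
  have ss: "square_integrable (s n)" for n
    by (rule square_integrable_bound[OF w s bound])
  have "(\<lambda>n. \<integral>t. (s n t - f t)\<^sup>2 \<partial>lebesgue) \<longlonglongrightarrow> integral\<^sup>L lebesgue (\<lambda>t::real. 0)"
  proof (rule integral_dominated_convergence)
    show "integrable lebesgue (\<lambda>t. 4 * (w t)\<^sup>2)"
      using w by (simp add: square_integrable_def)
    show "AE t in lebesgue. (\<lambda>n. (s n t - f t)\<^sup>2) \<longlonglongrightarrow> 0"
      using lim by eventually_elim (rule tendsto_null_power[OF LIM_zero], simp_all)
    show "AE t in lebesgue. norm ((s n t - f t)\<^sup>2) \<le> 4 * (w t)\<^sup>2" for n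
      using all fw
    proof eventually_elim
      fix t assume "\<forall>n. \<bar>s n t\<bar> \<le> w t" "\<bar>f t\<bar> \<le> w t"
      then have "\<bar>s n t\<bar> \<le> w t" "\<bar>f t\<bar> \<le> w t" by auto
      then have "\<bar>s n t - f t\<bar> \<le> \<bar>2 * w t\<bar>" by linarith
      then have "(s n t - f t)\<^sup>2 \<le> (2 * w t)\<^sup>2" by (simp only: abs_le_square_iff)
      then show "norm ((s n t - f t)\<^sup>2) \<le> 4 * (w t)\<^sup>2" by (simp add: power_mult_distrib)
    qed
  qed (use s f in auto)
  then have "(\<lambda>n. sqrt (\<integral>t. (s n t - f t)\<^sup>2 \<partial>lebesgue)) \<longlonglongrightarrow> 0"
    by (rule tendsto_real_sqrt[THEN tendsto_eq_rhs]) simp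
  then have "(\<lambda>n. dist (abs_L2 (s n)) (abs_L2 f)) \<longlonglongrightarrow> 0"
    by (simp add: dist_norm abs_L2_diff norm_abs_L2 ss sf square_integrable_diff)
  then show "(\<lambda>n. abs_L2 (s n)) \<longlonglongrightarrow> abs_L2 f"
    by (rule tendsto_dist_iff[THEN iffD2])
qed

subsection \<open>Completeness\<close>

instance L2 :: banach
proof
  fix X :: "nat \<Rightarrow> L2"
  assume X: "Cauchy X"
  have "\<exists>N. \<forall>m\<ge>N. \<forall>n\<ge>N. dist (X m) (X n) < (1/2) ^ k" for k :: nat
    using X by (simp add: Cauchy_def)
  then obtain N where N: "\<And>k m n. m \<ge> N k \<Longrightarrow> n \<ge> N k \<Longrightarrow> dist (X m) (X n) < (1/2) ^ k"
    by metis
  define r where "r = rec_nat (N 0) (\<lambda>k m. max (Suc m) (N (Suc k)))"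
  have r_Suc: "r (Suc k) = max (Suc (r k)) (N (Suc k))" for k
    by (simp add: r_def)
  have r: "strict_mono r"
    by (rule strict_monoI_Suc) (simp add: r_Suc)
  have rN: "N k \<le> r k" for k
    by (cases k) (simp_all add: r_def)
  have step: "dist (X (r (Suc k))) (X (r k)) < (1/2) ^ k" for k
    using rN[of k] strict_mono_less[OF r, of k "Suc k"] by (intro N) auto
  define f where "f k = rep_L2 (X (r k))" for k
  have f: "square_integrable (f k)" for k
    by (simp add: f_def square_integrable_rep)
  have af: "abs_L2 (f k) = X (r k)" for k
    by (simp add: f_def abs_rep_L2)
  define d where "d k t = \<bar>f (Suc k) t - f k t\<bar>" for k t
  have d: "square_integrable (d k)" for k
    unfolding d_def by (intro square_integrable_abs square_integrable_diff f)
  have nd: "norm (abs_L2 (d k)) \<le> (1/2) ^ k" for k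
  proof -
    have "norm (abs_L2 (d k)) = norm (abs_L2 (\<lambda>t. f (Suc k) t - f k t))"
      unfolding d_def
      by (simp add: norm_abs_L2 square_integrable_abs square_integrable_diff f)
    also have "\<dots> = dist (X (r (Suc k))) (X (r k))"
      by (simp add: dist_norm af[symmetric] abs_L2_diff f)
    finally show ?thesis using step[of k] by simp
  qed
  define g where "g n t = (\<Sum>k<n. d k t)" for n t
  have g: "square_integrable (g n)" for n
    unfolding g_def by (intro square_integrable_sum d)
  have d0: "0 \<le> d k t" for k t by (simp add: d_def)
  have g0: "0 \<le> g n t" for n t by (simp add: g_def sum_nonneg d0)
  have ng: "(\<integral>t. (g n t)\<^sup>2 \<partial>lebesgue) \<le> 4" for n
  proof -
    have "norm (abs_L2 (g n)) = norm (\<Sum>k<n. abs_L2 (d k))"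
      unfolding g_def by (simp add: abs_L2_sum d)
    also have "\<dots> \<le> (\<Sum>k<n. (1/2) ^ k)"
      by (intro order_trans[OF norm_sum] sum_mono nd)
    also have "\<dots> \<le> 2"
      by (subst geometric_sum) (auto simp: field_simps)
    finally have "sqrt (\<integral>t. (g n t)\<^sup>2 \<partial>lebesgue) \<le> 2"
      by (simp add: norm_abs_L2 g)
    then show ?thesis
      using real_sqrt_le_iff[of "\<integral>t. (g n t)\<^sup>2 \<partial>lebesgue" 4] by simp
  qed
  have gmeas [measurable]: "g n \<in> borel_measurable lebesgue" for n
    using g by (simp add: square_integrable_def)
  have fmeas [measurable]: "f n \<in> borel_measurable lebesgue" for n
    using f by (simp add: square_integrable_def)
  have ginc: "g m t \<le> g n t" if "m \<le> n" for m n t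
    unfolding g_def using that by (intro sum_mono2) (auto simp: d0)
  have nn: "(\<integral>\<^sup>+t. ennreal ((g n t)\<^sup>2) \<partial>lebesgue) \<le> 4" for n
    using g ennreal_leI[OF ng[of n]] by (subst nn_integral_eq_integral) (auto simp: square_integrable_def)
  have "(\<integral>\<^sup>+t. (SUP n. ennreal ((g n t)\<^sup>2)) \<partial>lebesgue) = (SUP n. \<integral>\<^sup>+t. ennreal ((g n t)\<^sup>2) \<partial>lebesgue)"
    by (rule nn_integral_monotone_convergence_SUP)
       (auto simp: incseq_def le_fun_def ginc g0 intro!: ennreal_leI power_mono)
  also have "\<dots> \<le> 4"
    by (rule SUP_least) (rule nn)
  finally have S4: "(\<integral>\<^sup>+t. (SUP n. ennreal ((g n t)\<^sup>2)) \<partial>lebesgue) \<le> 4" .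
  then have "(\<integral>\<^sup>+t. (SUP n. ennreal ((g n t)\<^sup>2)) \<partial>lebesgue) \<noteq> \<infinity>"
    by (auto simp: top_unique)
  then have "AE t in lebesgue. (SUP n. ennreal ((g n t)\<^sup>2)) \<noteq> \<infinity>"
    by (intro nn_integral_PInf_AE) auto
  then have summ: "AE t in lebesgue. summable (\<lambda>k. d k t)"
  proof eventually_elim
    fix t assume *: "(SUP n. ennreal ((g n t)\<^sup>2)) \<noteq> \<infinity>"
    then obtain c where c: "0 \<le> c" "(SUP n. ennreal ((g n t)\<^sup>2)) = ennreal c"
      by (cases "SUP n. ennreal ((g n t)\<^sup>2)") auto
    have "g n t \<le> sqrt c" for n
    proof -
      have "ennreal ((g n t)\<^sup>2) \<le> ennreal c"
        unfolding c(2)[symmetric] by (rule SUP_upper) simp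
      then show ?thesis using c(1) by (simp add: real_le_rsqrt)
    qed
    then show "summable (\<lambda>k. d k t)"
      unfolding g_def by (intro summableI_nonneg_bounded[where x = "sqrt c"] d0)
  qed
  define H where "H t = (\<Sum>k. d k t)" for t
  have dmeas [measurable]: "d k \<in> borel_measurable lebesgue" for k
    using d by (simp add: square_integrable_def)
  have Hmeas [measurable]: "H \<in> borel_measurable lebesgue"
    unfolding H_def by measurable
  have H: "square_integrable H"
    unfolding square_integrable_def
  proof (intro conjI Hmeas integrableI_bounded)
    have "(\<integral>\<^sup>+t. ennreal (norm ((H t)\<^sup>2)) \<partial>lebesgue) \<le> (\<integral>\<^sup>+t. (SUP n. ennreal ((g n t)\<^sup>2)) \<partial>lebesgue)"
    proof (rule nn_integral_mono_AE)
      show "AE t in lebesgue. ennreal (norm ((H t)\<^sup>2)) \<le> (SUP n. ennreal ((g n t)\<^sup>2))"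
        using summ
      proof eventually_elim
        fix t assume "summable (\<lambda>k. d k t)"
        then have "(\<lambda>n. g n t) \<longlonglongrightarrow> H t"
          unfolding g_def H_def by (rule summable_LIMSEQ)
        then have "(\<lambda>n. ennreal ((g n t)\<^sup>2)) \<longlonglongrightarrow> ennreal ((H t)\<^sup>2)"
          by (intro tendsto_ennrealI tendsto_power)
        then have "ennreal ((H t)\<^sup>2) \<le> (SUP n. ennreal ((g n t)\<^sup>2))"
          by (rule LIMSEQ_le_const2) (intro exI[where x = 0] allI impI SUP_upper UNIV_I)
        then show "ennreal (norm ((H t)\<^sup>2)) \<le> (SUP n. ennreal ((g n t)\<^sup>2))"
          by simp
      qed
    qed
    also note S4
    also have "(4::ennreal) < \<infinity>" by simp
    finally show "(\<integral>\<^sup>+t. ennreal (norm ((H t)\<^sup>2)) \<partial>lebesgue) < \<infinity>" .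
  qed simp
  have tele: "f n t = f 0 t + (\<Sum>k<n. f (Suc k) t - f k t)" for n t
    by (induction n) auto
  have lim: "AE t in lebesgue. (\<lambda>n. f n t) \<longlonglongrightarrow> lim (\<lambda>n. f n t)"
    using summ
  proof eventually_elim
    fix t assume "summable (\<lambda>k. d k t)"
    then have "summable (\<lambda>k. f (Suc k) t - f k t)"
      unfolding d_def by (rule summable_rabs_cancel)
    then have "convergent (\<lambda>n. f 0 t + (\<Sum>k<n. f (Suc k) t - f k t))"
      by (intro convergent_add convergent_const) (simp add: summable_iff_convergent)
    then show "(\<lambda>n. f n t) \<longlonglongrightarrow> lim (\<lambda>n. f n t)"
      by (simp only: tele[symmetric] convergent_LIMSEQ_iff)
  qed
  have bound: "AE t in lebesgue. \<bar>f n t\<bar> \<le> \<bar>f 0 t\<bar> + H t" for n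
    using summ
  proof eventually_elim
    fix t assume s: "summable (\<lambda>k. d k t)"
    have "\<bar>f n t\<bar> \<le> \<bar>f 0 t\<bar> + \<bar>\<Sum>k<n. f (Suc k) t - f k t\<bar>"
      by (subst tele) (rule abs_triangle_ineq)
    also have "\<bar>\<Sum>k<n. f (Suc k) t - f k t\<bar> \<le> (\<Sum>k<n. d k t)"
      unfolding d_def by (rule sum_abs)
    also have "\<dots> \<le> H t"
      unfolding H_def by (intro sum_le_suminf s) (auto simp: d0)
    finally show "\<bar>f n t\<bar> \<le> \<bar>f 0 t\<bar> + H t" by simp
  qed
  have w: "square_integrable (\<lambda>t. \<bar>f 0 t\<bar> + H t)"
    by (rule square_integrable_add[OF square_integrable_abs[OF f[of 0]] H])
  have F: "(\<lambda>t. lim (\<lambda>n. f n t)) \<in> borel_measurable lebesgue"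
    by (rule borel_measurable_lim_metric[where f = f]) (rule fmeas)
  have "(\<lambda>n. abs_L2 (f n)) \<longlonglongrightarrow> abs_L2 (\<lambda>t. lim (\<lambda>n. f n t))"
    by (rule abs_L2_dominated_convergence(2)
          [of "\<lambda>t. \<bar>f 0 t\<bar> + H t" "\<lambda>t. lim (\<lambda>n. f n t)" f, OF w F fmeas lim bound])
  then have "(X \<circ> r) \<longlonglongrightarrow> abs_L2 (\<lambda>t. lim (\<lambda>n. f n t))"
    by (simp add: af o_def)
  then show "convergent X"
    using Cauchy_converges_subseq[OF X r] by (auto simp: convergent_def)
qed

subsection \<open>Separability\<close>

lemma countable_span_separable:
  fixes B :: "'a::real_normed_vector set"
  assumes "countable B"
  shows "\<exists>C. countable C \<and> closure (span B) \<subseteq> closure C"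
proof -
  define comb where "comb l = (\<Sum>(q, b)\<leftarrow>l. real_of_rat q *\<^sub>R b)" for l :: "(rat \<times> 'a) list"
  define C where "C = comb ` lists (UNIV \<times> B)"
  have "countable C"
    unfolding C_def using assms by (intro countable_image countable_lists countable_SIGMA) auto
  have C_add: "x + y \<in> C" if "x \<in> C" "y \<in> C" for x y
  proof -
    from that obtain l m where "l \<in> lists (UNIV \<times> B)" "m \<in> lists (UNIV \<times> B)" "x = comb l" "y = comb m"
      by (auto simp: C_def)
    then have "l @ m \<in> lists (UNIV \<times> B)" "x + y = comb (l @ m)"
      by (auto simp: comb_def)
    then show ?thesis by (auto simp: C_def)
  qed
  have comb_scale: "real_of_rat q *\<^sub>R comb l = comb (map (\<lambda>(p, b). (q * p, b)) l)" for q l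
    by (induction l) (auto simp: comb_def scaleR_add_right of_rat_mult)
  have C_scale: "real_of_rat q *\<^sub>R x \<in> C" if x: "x \<in> C" for q x
  proof -
    from x obtain l where l: "l \<in> lists (UNIV \<times> B)" "x = comb l"
      by (auto simp: C_def)
    have "map (\<lambda>(p, b). (q * p, b)) l \<in> lists (UNIV \<times> B)"
      using l(1) by (auto simp: in_lists_conv_set)
    then show ?thesis
      unfolding C_def l(2) comb_scale by (rule imageI)
  qed
  have "comb [] \<in> C" unfolding C_def by (rule imageI) simp
  then have C_zero: "0 \<in> C" by (simp add: comb_def)
  have C_base: "b \<in> C" if "b \<in> B" for b
  proof -
    have "comb [(1, b)] \<in> C" unfolding C_def using that by (intro imageI) simp
    then show ?thesis by (simp add: comb_def)
  qed
  have "subspace (closure C)"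
    unfolding subspace_def
  proof (intro conjI ballI allI)
    show "0 \<in> closure C" using C_zero closure_subset by blast
    show "x + y \<in> closure C" if "x \<in> closure C" "y \<in> closure C" for x y
    proof -
      from that obtain u v where "\<forall>n. u n \<in> C" "u \<longlonglongrightarrow> x" "\<forall>n. v n \<in> C" "v \<longlonglongrightarrow> y"
        unfolding closure_sequential by blast
      then have "(\<forall>n. u n + v n \<in> C) \<and> (\<lambda>n. u n + v n) \<longlonglongrightarrow> x + y"
        by (auto intro: C_add tendsto_add)
      then show ?thesis
        unfolding closure_sequential by (intro exI[where x = "\<lambda>n. u n + v n"])
    qed
    show "c *\<^sub>R x \<in> closure C" if x: "x \<in> closure C" for c x
    proof -
      from x obtain u where u: "\<forall>n. u n \<in> C" "u \<longlonglongrightarrow> x"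
        unfolding closure_sequential by blast
      have "\<exists>q. \<bar>real_of_rat q - c\<bar> < 1 / real (Suc n)" for n
      proof -
        have "\<exists>q. c < real_of_rat q \<and> real_of_rat q < c + 1 / real (Suc n)"
          by (rule of_rat_dense) simp
        then obtain q where "c < real_of_rat q" "real_of_rat q < c + 1 / real (Suc n)" by blast
        then have "\<bar>real_of_rat q - c\<bar> < 1 / real (Suc n)" by linarith
        then show ?thesis by blast
      qed
      then obtain q where q: "\<And>n. \<bar>real_of_rat (q n) - c\<bar> < 1 / real (Suc n)" by metis
      have "(\<lambda>n. real_of_rat (q n) - c) \<longlonglongrightarrow> 0"
        by (rule LIMSEQ_norm_0) (use q in \<open>simp only: real_norm_def\<close>)
      then have "(\<lambda>n. real_of_rat (q n)) \<longlonglongrightarrow> c" by (rule LIM_zero_cancel)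
      then have "(\<forall>n. real_of_rat (q n) *\<^sub>R u n \<in> C) \<and> (\<lambda>n. real_of_rat (q n) *\<^sub>R u n) \<longlonglongrightarrow> c *\<^sub>R x"
        using u by (auto intro: C_scale tendsto_scaleR)
      then show ?thesis
        unfolding closure_sequential by (intro exI[where x = "\<lambda>n. real_of_rat (q n) *\<^sub>R u n"])
    qed
  qed
  moreover have "B \<subseteq> closure C" using C_base closure_subset by blast
  ultimately have "span B \<subseteq> closure C" by (rule span_minimal[rotated])
  then have "closure (span B) \<subseteq> closure C" by (simp add: closure_minimal)
  with \<open>countable C\<close> show ?thesis by blast
qed

lemma subspace_closure:
  fixes S :: "'a::real_normed_vector set"
  assumes S: "subspace S"
  shows "subspace (closure S)"
  unfolding subspace_def
proof (intro conjI ballI allI)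
  show "0 \<in> closure S" using subspace_0[OF S] closure_subset by blast
  show "x + y \<in> closure S" if "x \<in> closure S" "y \<in> closure S" for x y
  proof -
    from that obtain u v where "\<forall>n. u n \<in> S" "u \<longlonglongrightarrow> x" "\<forall>n. v n \<in> S" "v \<longlonglongrightarrow> y"
      unfolding closure_sequential by blast
    then have "(\<forall>n. u n + v n \<in> S) \<and> (\<lambda>n. u n + v n) \<longlonglongrightarrow> x + y"
      by (auto intro: subspace_add[OF S] tendsto_add)
    then show ?thesis
      unfolding closure_sequential by (intro exI[where x = "\<lambda>n. u n + v n"])
  qed
  show "c *\<^sub>R x \<in> closure S" if x: "x \<in> closure S" for c x
  proof -
    from x obtain u where "\<forall>n. u n \<in> S" "u \<longlonglongrightarrow> x"
      unfolding closure_sequential by blast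
    then have "(\<forall>n. c *\<^sub>R u n \<in> S) \<and> (\<lambda>n. c *\<^sub>R u n) \<longlonglongrightarrow> c *\<^sub>R x"
      by (auto intro: subspace_scale[OF S] tendsto_scaleR)
    then show ?thesis
      unfolding closure_sequential by (intro exI[where x = "\<lambda>n. c *\<^sub>R u n"])
  qed
qed

lemma square_integrable_indicator:
  assumes "A \<in> sets lebesgue" "A \<subseteq> {-c..c}"
  shows "square_integrable (indicator A)"
proof -
  have "square_integrable (indicator {-c..c})"
    unfolding square_integrable_def
    by (auto simp: power2_eq_square indicator_inter_arith[symmetric] lmeasurable_iff_integrable[symmetric]
        intro!: borel_measurable_indicator)
  then show ?thesis
    by (rule square_integrable_bound)
       (use assms in \<open>auto simp: indicator_def intro!: borel_measurable_indicator AE_I2\<close>)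
qed

definition rational_steps :: "L2 set" where
  "rational_steps = (\<lambda>(p, q). abs_L2 (indicator {real_of_rat p..real_of_rat q})) ` UNIV"

abbreviation steps_closure :: "L2 set" where
  "steps_closure \<equiv> closure (span rational_steps)"

lemma steps_closure_lim:
  assumes "\<And>n. u n \<in> steps_closure" "u \<longlonglongrightarrow> x"
  shows "x \<in> steps_closure"
  using closed_sequentially[OF closed_closure] assms by blast

lemma steps_closure_subspace: "subspace steps_closure"
  by (rule subspace_closure) simp

lemma interval_in_steps_closure: "abs_L2 (indicator {a..b}) \<in> steps_closure"
proof -
  have "\<exists>p. a - 1 / real (Suc n) < real_of_rat p \<and> real_of_rat p < a" for n
    by (rule of_rat_dense) simp
  then obtain p where p: "\<And>n. a - 1 / real (Suc n) < real_of_rat (p n)" "\<And>n. real_of_rat (p n) < a"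
    by metis
  have "\<exists>q. b < real_of_rat q \<and> real_of_rat q < b + 1 / real (Suc n)" for n
    by (rule of_rat_dense) simp
  then obtain q where q: "\<And>n. b < real_of_rat (q n)" "\<And>n. real_of_rat (q n) < b + 1 / real (Suc n)"
    by metis
  define s where "s n = (indicator {real_of_rat (p n)..real_of_rat (q n)} :: real \<Rightarrow> real)" for n
  have le1: "1 / real (Suc n) \<le> 1" for n by simp
  have lim0: "(\<lambda>n. 1 / real (Suc n)) \<longlonglongrightarrow> 0" by (rule LIMSEQ_Suc) (rule lim_1_over_n)
  have "(\<lambda>n. abs_L2 (s n)) \<longlonglongrightarrow> abs_L2 (indicator {a..b})"
  proof (rule abs_L2_dominated_convergence)
    show "square_integrable (indicator {a - 1..b + 1})"
      by (rule square_integrable_indicator[where c = "\<bar>a\<bar> + \<bar>b\<bar> + 1"]) auto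
    show "AE t in lebesgue. \<bar>s n t\<bar> \<le> indicator {a - 1..b + 1} t" for n
    proof -
      have "a - 1 \<le> real_of_rat (p n)" "real_of_rat (q n) \<le> b + 1"
        using p(1)[of n] q(2)[of n] le1[of n] by linarith+
      then show ?thesis by (intro AE_I2) (auto simp: s_def indicator_def)
    qed
    show "AE t in lebesgue. (\<lambda>n. s n t) \<longlonglongrightarrow> indicator {a..b} t"
    proof (rule AE_I2)
      fix t
      have "eventually (\<lambda>n. s n t = indicator {a..b} t) sequentially"
      proof (cases "t \<in> {a..b}")
        case True
        then show ?thesis
          using less_imp_le[OF p(2)] less_imp_le[OF q(1)]
          by (intro always_eventually) (auto simp: s_def indicator_def intro: order_trans)
      next
        case False
        define e where "e = (if t < a then a - t else t - b)"
        have "e > 0 " using False by (auto simp: e_def)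
        then have "eventually (\<lambda>n. 1 / real (Suc n) < e) sequentially"
          using order_tendstoD(2)[OF lim0] by simp
        then show ?thesis
        proof eventually_elim
          case (elim n)
          then show ?case
            using False p(1)[of n] q(2)[of n] by (auto simp: s_def indicator_def e_def split: if_splits)
        qed
      qed
      then show "(\<lambda>n. s n t) \<longlonglongrightarrow> indicator {a..b} t"
        by (rule tendsto_eventually)
    qed
  qed (auto simp: s_def intro!: borel_measurable_indicator)
  moreover have "abs_L2 (s n) \<in> steps_closure" for n
    using closure_subset span_superset by (fastforce simp: s_def rational_steps_def)
  ultimately show ?thesis by (rule steps_closure_lim[rotated])
qed

lemma borel_set_in_steps_closure:
  assumes "A \<in> sets borel"
  shows "abs_L2 (indicator (A \<inter> {-c..c})) \<in> steps_closure"
  using assms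
proof (induction A rule: borel_set_induct)
  case empty
  show ?case
  proof -
    have "{} \<inter> {-c..c} = {1..0::real}" by simp
    then show ?thesis by (simp only: interval_in_steps_closure)
  qed
next
  case (interval a b)
  have "{a..b} \<inter> {-c..c} = {max a (-c)..min b c}" by auto
  then show ?case by (simp add: interval_in_steps_closure)
next
  case (compl A)
  have A: "A \<inter> {-c..c} \<in> sets lebesgue" using compl(1) by auto
  have "abs_L2 (indicator (- A \<inter> {-c..c})) =
      abs_L2 (\<lambda>t. indicator {-c..c} t - indicator (A \<inter> {-c..c}) t)"
    by (rule arg_cong[where f = abs_L2]) (auto simp: indicator_def)
  also have "\<dots> = abs_L2 (indicator {-c..c}) - abs_L2 (indicator (A \<inter> {-c..c}))"
    by (intro abs_L2_diff[symmetric] square_integrable_indicator[where c = c] A) auto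
  finally show ?case
    using interval_in_steps_closure compl(2) steps_closure_subspace by (simp add: subspace_diff)
next
  case (union A)
  have A: "A i \<inter> {-c..c} \<in> sets lebesgue" for i using union(2)[of i] by auto
  define s where "s n t = (\<Sum>i<n. indicator (A i \<inter> {-c..c}) t :: real)" for n t
  have disj: "disjoint_family (\<lambda>i. A i \<inter> {-c..c})"
    using union(1) by (auto simp: disjoint_family_on_def)
  have s_eq: "s n = indicator ((\<Union>i<n. A i) \<inter> {-c..c})" for n
  proof
    fix t
    have "s n t = indicator (\<Union>i<n. A i \<inter> {-c..c}) t"
      unfolding s_def
      by (rule indicator_UN_disjoint[symmetric])
         (use disj in \<open>auto simp: disjoint_family_on_def\<close>)
    then show "s n t = indicator ((\<Union>i<n. A i) \<inter> {-c..c}) t" by simp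
  qed
  have "(\<lambda>n. abs_L2 (s n)) \<longlonglongrightarrow> abs_L2 (indicator ((\<Union>i. A i) \<inter> {-c..c}))"
  proof (rule abs_L2_dominated_convergence)
    show "square_integrable (indicator {-c..c})"
      by (rule square_integrable_indicator[where c = c]) auto
    show "AE t in lebesgue. (\<lambda>n. s n t) \<longlonglongrightarrow> indicator ((\<Union>i. A i) \<inter> {-c..c}) t"
    proof (rule AE_I2)
      fix t
      show "(\<lambda>n. s n t) \<longlonglongrightarrow> indicator ((\<Union>i. A i) \<inter> {-c..c}) t"
        unfolding s_eq indicator_inter_arith
        by (intro tendsto_mult tendsto_const LIMSEQ_indicator_UN)
    qed
    show "AE t in lebesgue. \<bar>s n t\<bar> \<le> indicator {-c..c} t" for n
      by (intro AE_I2) (auto simp: s_eq indicator_def)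
    have "(\<Union>i. A i) \<in> sets lebesgue" "(\<Union>i<n. A i) \<in> sets lebesgue" for n
      using union(2) by auto
    then show "indicator ((\<Union>i. A i) \<inter> {-c..c}) \<in> borel_measurable lebesgue"
      "s n \<in> borel_measurable lebesgue" for n
      unfolding s_eq by (intro borel_measurable_indicator sets.Int; simp)+
  qed
  moreover have "abs_L2 (s n) \<in> steps_closure" for n
  proof -
    have "abs_L2 (s n) = (\<Sum>i<n. abs_L2 (indicator (A i \<inter> {-c..c})))"
      unfolding s_def by (intro abs_L2_sum[symmetric] square_integrable_indicator[where c = c] A) auto
    then show ?thesis
      using union(3) steps_closure_subspace by (auto intro: subspace_sum)
  qed
  ultimately show ?case by (rule steps_closure_lim[rotated])
qed

lemma steps_closure_UNIV: "steps_closure = UNIV"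
proof (rule UNIV_eq_I[symmetric])
  fix x
  obtain f0 where f0: "square_integrable f0" "x = abs_L2 f0"
    by (rule abs_L2_cases)
  obtain f where f: "f \<in> borel_measurable lborel" and ff0: "AE t in lborel. f0 t = f t"
    using completion_ex_borel_measurable_real[of f0 lborel] f0(1)
    by (auto simp: square_integrable_def)
  have fl: "f \<in> borel_measurable lebesgue"
    using f by (rule measurable_completion)
  have ff0': "AE t in lebesgue. f0 t = f t"
    using ff0 by (rule AE_completion)
  have sf: "square_integrable f"
    by (rule square_integrable_bound[OF square_integrable_abs[OF f0(1)] fl])
       (use ff0' in \<open>auto elim: eventually_mono\<close>)
  have x: "x = abs_L2 f"
    unfolding f0(2) by (rule abs_L2_cong[OF f0(1) sf ff0'])
  obtain F where F: "\<And>i. simple_function lborel (F i)" "\<And>t. (\<lambda>i. F i t) \<longlonglongrightarrow> f t"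
      "\<And>i t. \<bar>F i t\<bar> \<le> 2 * \<bar>f t\<bar>"
    using borel_measurable_implies_sequence_metric[OF f, of 0] by (auto simp: dist_real_def)
  define s where "s n t = F n t * indicator {-real n..real n} t" for n t
  have "(\<lambda>n. abs_L2 (s n)) \<longlonglongrightarrow> abs_L2 f"
  proof (rule abs_L2_dominated_convergence)
    show "square_integrable (\<lambda>t. 2 * \<bar>f t\<bar>)"
      by (intro square_integrable_scale square_integrable_abs sf)
    show "AE t in lebesgue. (\<lambda>n. s n t) \<longlonglongrightarrow> f t"
    proof (rule AE_I2)
      fix t
      have "eventually (\<lambda>n. \<bar>t\<bar> \<le> real n) sequentially"
        by (rule eventually_sequentiallyI[of "nat \<lceil>\<bar>t\<bar>\<rceil>"]) linarith
      then have "eventually (\<lambda>n. F n t = s n t) sequentially"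
        by eventually_elim (auto simp: s_def indicator_def)
      then show "(\<lambda>n. s n t) \<longlonglongrightarrow> f t"
        using F(2)[of t] by (rule Lim_transform_eventually[rotated])
    qed
    show "AE t in lebesgue. \<bar>s n t\<bar> \<le> 2 * \<bar>f t\<bar>" for n
      using F(3)[of n] by (intro AE_I2) (auto simp: s_def indicator_def)
    have "F n \<in> borel_measurable lebesgue" for n
      using borel_measurable_simple_function[OF F(1)] by (rule measurable_completion)
    then show "s n \<in> borel_measurable lebesgue" for n
      unfolding s_def by (intro borel_measurable_times borel_measurable_indicator) auto
  qed (rule fl)
  moreover have "abs_L2 (s n) \<in> steps_closure" for n
  proof -
    define R where "R = F n ` UNIV"
    have R: "finite R" using F(1)[of n] by (simp add: simple_function_def R_def)
    have Fy: "F n -` {y} \<in> sets borel" for y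
    proof (cases "y \<in> R")
      case True
      then show ?thesis using F(1)[of n] by (auto simp: simple_function_def R_def)
    next
      case False
      then have "F n -` {y} = {}" by (auto simp: R_def)
      then show ?thesis by simp
    qed
    define h where "h y = (indicator (F n -` {y} \<inter> {-real n..real n}) :: real \<Rightarrow> real)" for y
    have h: "square_integrable (h y)" for y
      unfolding h_def using Fy[of y] by (intro square_integrable_indicator[where c = "real n"]) auto
    have "s n = (\<lambda>t. \<Sum>y\<in>R. y * h y t)"
    proof
      fix t
      have "(\<Sum>y\<in>R. y * h y t) = (\<Sum>y\<in>{F n t}. y * h y t)"
        by (rule sum.mono_neutral_right) (use R in \<open>auto simp: R_def h_def indicator_def\<close>)
      then show "s n t = (\<Sum>y\<in>R. y * h y t)"
        by (simp add: s_def h_def indicator_def)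
    qed
    then have "abs_L2 (s n) = (\<Sum>y\<in>R. y *\<^sub>R abs_L2 (h y))"
      by (simp add: abs_L2_sum[symmetric] abs_L2_scale h square_integrable_scale)
    also have "\<dots> \<in> steps_closure"
      using borel_set_in_steps_closure[OF Fy] steps_closure_subspace
      by (intro subspace_sum subspace_scale) (auto simp: h_def)
    finally show ?thesis .
  qed
  ultimately show "x \<in> steps_closure"
    unfolding x by (rule steps_closure_lim[rotated])
qed

instance L2 :: second_countable_topology
proof
  have "countable rational_steps"
    unfolding rational_steps_def by simp
  then obtain C where C: "countable C" "closure C = (UNIV :: L2 set)"
    using countable_span_separable[of rational_steps] unfolding steps_closure_UNIV by blast
  define \<B> where "\<B> = (\<lambda>(x, q). ball x (real_of_rat q)) ` (C \<times> UNIV)"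
  have "countable \<B>"
    unfolding \<B>_def using C(1) by auto
  moreover have "topological_basis \<B>"
  proof (rule topological_basisI)
    show "open U" if "U \<in> \<B>" for U using that by (auto simp: \<B>_def)
    fix U :: "L2 set" and x assume "open U" "x \<in> U"
    then obtain e where e: "e > 0" "ball x e \<subseteq> U" by (auto simp: open_contains_ball)
    have "\<exists>q. 0 < real_of_rat q \<and> real_of_rat q < e / 2"
      by (rule of_rat_dense) (use e(1) in simp)
    then obtain q where q: "0 < real_of_rat q" "real_of_rat q < e / 2" by blast
    obtain y where y: "y \<in> C" "dist y x < real_of_rat q"
      using closure_approachable[of x C] C(2) q(1) by blast
    have "ball y (real_of_rat q) \<subseteq> ball x e"
    proof
      fix z assume "z \<in> ball y (real_of_rat q)"
      then have "dist x z < real_of_rat q + real_of_rat q"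
        using y(2) dist_triangle[of x z y] by (simp add: dist_commute)
      then show "z \<in> ball x e" using q(2) by simp
    qed
    moreover have "x \<in> ball y (real_of_rat q)" using y(2) by simp
    moreover have "ball y (real_of_rat q) \<in> \<B>" using y(1) by (auto simp: \<B>_def)
    ultimately show "\<exists>B'\<in>\<B>. x \<in> B' \<and> B' \<subseteq> U" by (meson e(2) subset_trans)
  qed
  ultimately show "\<exists>B :: L2 set set. countable B \<and> open = generate_topology B"
    using topological_basis_imp_subbasis by blast
qed

section \<open>Square integrable functions on a set\<close>

definition L2_on :: "real set \<Rightarrow> L2 set" where
  "L2_on T = {f. AE t in lebesgue. t \<notin> T \<longrightarrow> rep_L2 f t = 0}"

lemma inner_L2_on:
  assumes "f \<in> L2_on T" "T \<in> sets lebesgue"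
  shows "inner f g = (LINT t:T|lebesgue. rep_L2 f t * rep_L2 g t)"
proof -
  have m: "rep_L2 x \<in> borel_measurable lebesgue" for x
    using square_integrable_rep by (simp add: square_integrable_def)
  have "inner f g = inner (abs_L2 (rep_L2 f)) (abs_L2 (rep_L2 g))"
    by (simp add: abs_rep_L2)
  also have "\<dots> = (\<integral>t. rep_L2 f t * rep_L2 g t \<partial>lebesgue)"
    by (subst inner_L2.abs_eq) (simp_all add: square_integrable_rep)
  also have "\<dots> = (LINT t:T|lebesgue. rep_L2 f t * rep_L2 g t)"
    unfolding set_lebesgue_integral_def
  proof (rule integral_cong_AE)
    show "AE t in lebesgue. rep_L2 f t * rep_L2 g t =
        indicat_real T t *\<^sub>R (rep_L2 f t * rep_L2 g t)"
      using assms(1) unfolding L2_on_def by (auto elim!: eventually_mono simp: indicator_def)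
  qed (use m assms(2) in \<open>auto intro!: borel_measurable_times borel_measurable_scaleR\<close>)
  finally show ?thesis .
qed

lemma abs_L2_in_L2_on:
  assumes "square_integrable f"
  shows "abs_L2 f \<in> L2_on T \<longleftrightarrow> (AE t in lebesgue. t \<notin> T \<longrightarrow> f t = 0)"
proof -
  have "AE t in lebesgue. rep_L2 (abs_L2 f) t = f t"
    using Quotient3_rep_abs[OF Quotient3_L2, of f] assms by simp
  then have "AE t in lebesgue. (t \<notin> T \<longrightarrow> rep_L2 (abs_L2 f) t = 0) \<longleftrightarrow> (t \<notin> T \<longrightarrow> f t = 0)"
    by eventually_elim simp
  then show ?thesis
    unfolding L2_on_def mem_Collect_eq by (rule eventually_subst)
qed

section \<open>Functional random variables\<close>

definition functional_random_variable :: "'w measure \<Rightarrow> real set \<Rightarrow> ('w \<Rightarrow> L2) \<Rightarrow> bool" where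
  "functional_random_variable M T X \<longleftrightarrow>
     X \<in> borel_measurable M \<and> (\<forall>\<omega>\<in>space M. X \<omega> \<in> L2_on T) \<and>
     integrable M (\<lambda>\<omega>. norm (X \<omega>) ^ 4)"

text \<open>
  Expectations of random elements are Bochner integrals in \<^typ>\<open>L2\<close>, since a class modulo null
  sets has no value at a single point \<open>t\<close>.
\<close>

definition mean_function :: "'w measure \<Rightarrow> ('w \<Rightarrow> L2) \<Rightarrow> L2" where
  "mean_function M X = (\<integral>\<omega>. X \<omega> \<partial>M)"

definition covariance_operator :: "'w measure \<Rightarrow> ('w \<Rightarrow> L2) \<Rightarrow> L2 \<Rightarrow> L2" where
  "covariance_operator M X \<eta> =
     (\<integral>\<omega>. inner (X \<omega> - mean_function M X) \<eta> *\<^sub>R (X \<omega> - mean_function M X) \<partial>M)"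

definition compact_operator_on :: "'a::real_normed_vector set \<Rightarrow> ('a \<Rightarrow> 'a) \<Rightarrow> bool" where
  "compact_operator_on H A \<longleftrightarrow>
     A ` H \<subseteq> H \<and> (\<forall>x\<in>H. \<forall>y\<in>H. A (x + y) = A x + A y) \<and> (\<forall>c. \<forall>x\<in>H. A (c *\<^sub>R x) = c *\<^sub>R A x) \<and>
     compact (closure (A ` (H \<inter> cball 0 1)))"

text \<open>
  Eigenvalues \<open>l\<close> and eigenfunctions \<open>\<psi>\<close> are indexed from 1; index 0 is unused. Since the \<open>\<psi> k\<close>
  form an orthonormal basis of \<open>H\<close>, the sequence \<open>l\<close> lists all eigenvalues of \<open>A\<close> on \<open>H\<close>, with
  multiplicity.
\<close>

definition eigensystem :: "'a::real_inner set \<Rightarrow> ('a \<Rightarrow> 'a) \<Rightarrow> (nat \<Rightarrow> real) \<Rightarrow> (nat \<Rightarrow> 'a) \<Rightarrow> bool" where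
  "eigensystem H A l \<psi> \<longleftrightarrow>
     (\<forall>j\<ge>1. \<forall>k\<ge>j. l k \<le> l j) \<and> (\<forall>k\<ge>1. 0 \<le> l k) \<and> summable (\<lambda>k. l (Suc k)) \<and>
     (\<forall>k\<ge>1. A (\<psi> k) = l k *\<^sub>R \<psi> k) \<and>
     (\<forall>j\<ge>1. \<forall>k\<ge>1. inner (\<psi> j) (\<psi> k) = (if j = k then 1 else 0)) \<and>
     closure (span (\<psi> ` {1..})) = H"

section \<open>The functional Mahalanobis semi-distance\<close>

definition tensor_square :: "'a::real_inner \<Rightarrow> 'a \<Rightarrow> 'a" where
  "tensor_square f g = inner f g *\<^sub>R f"

definition regularized_sqrt_inverse ::
    "(nat \<Rightarrow> real) \<Rightarrow> (nat \<Rightarrow> 'a::real_inner) \<Rightarrow> nat \<Rightarrow> 'a \<Rightarrow> 'a" where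
  "regularized_sqrt_inverse l \<psi> K \<zeta> = (\<Sum>k=1..K. (1 / sqrt (l k)) *\<^sub>R tensor_square (\<psi> k) \<zeta>)"

definition functional_mahalanobis ::
    "(nat \<Rightarrow> real) \<Rightarrow> (nat \<Rightarrow> 'a::real_inner) \<Rightarrow> nat \<Rightarrow> 'a \<Rightarrow> 'a \<Rightarrow> real" where
  "functional_mahalanobis l \<psi> K x y =
     sqrt (inner (regularized_sqrt_inverse l \<psi> K (x - y)) (regularized_sqrt_inverse l \<psi> K (x - y)))"

definition fpc_score :: "'a::real_inner \<Rightarrow> (nat \<Rightarrow> 'a) \<Rightarrow> 'a \<Rightarrow> nat \<Rightarrow> real" where
  "fpc_score \<mu> \<psi> x k = inner (x - \<mu>) (\<psi> k)"

definition standardized_fpc_score ::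
    "'a::real_inner \<Rightarrow> (nat \<Rightarrow> real) \<Rightarrow> (nat \<Rightarrow> 'a) \<Rightarrow> 'a \<Rightarrow> nat \<Rightarrow> real" where
  "standardized_fpc_score \<mu> l \<psi> x k = fpc_score \<mu> \<psi> x k / sqrt (l k)"

end

theory Submission
  imports Defs
begin

text \<open>
  The regularized square root inverse sends \<open>\<chi>1 \<omega> - \<chi>2 \<omega>\<close> to a linear combination of the
  orthonormal eigenfunctions \<open>\<psi> 1, \<dots>, \<psi> K\<close>, whose \<open>k\<close>-th coefficient is the inner product of
  the difference with \<open>\<psi> k\<close>, divided by \<open>sqrt (l k)\<close>. The common mean cancels in
  \<open>\<chi>1 \<omega> - \<chi>2 \<omega> = (\<chi>1 \<omega> - \<mu>) - (\<chi>2 \<omega> - \<mu>)\<close>, so this coefficient is the difference of the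
  standardized scores (lemma \<open>standardized_fpc_score_diff\<close>). By Pythagoras' theorem
  (lemma \<open>inner_orthonormal_sum\<close>) the squared norm of the combination is the sum of the squared
  coefficients. This argument concerns two fixed vectors
  (lemma \<open>functional_mahalanobis_eq_scores\<close>), and it is applied at each outcome \<open>\<omega>\<close>.
\<close>

lemma inner_orthonormal_sum:
  fixes e :: "'i \<Rightarrow> 'a::real_inner"
  assumes "finite I"
    and "\<And>i j. i \<in> I \<Longrightarrow> j \<in> I \<Longrightarrow> inner (e i) (e j) = (if i = j then 1 else 0)"
  shows "inner (\<Sum>i\<in>I. c i *\<^sub>R e i) (\<Sum>i\<in>I. c i *\<^sub>R e i) = (\<Sum>i\<in>I. (c i)\<^sup>2)"
proof -
  have "inner (\<Sum>i\<in>I. c i *\<^sub>R e i) (\<Sum>i\<in>I. c i *\<^sub>R e i) =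
      (\<Sum>i\<in>I. \<Sum>j\<in>I. c i * (c j * inner (e i) (e j)))"
    by (simp add: inner_sum_left inner_sum_right sum_distrib_left inner_commute mult.left_commute)
  also have "\<dots> = (\<Sum>i\<in>I. \<Sum>j\<in>I. if i = j then c i * c j else 0)"
    using assms(2) by (intro sum.cong) auto
  also have "\<dots> = (\<Sum>i\<in>I. (c i)\<^sup>2)"
    using assms(1) by (simp add: power2_eq_square)
  finally show ?thesis .
qed

text \<open>
  The centring cancels in the difference of two scores, which leaves the coefficient of
  \<open>x - y\<close> along \<open>\<psi> k\<close> under the regularized square root inverse.
\<close>

lemma standardized_fpc_score_diff:
  "standardized_fpc_score \<mu> l \<psi> x k - standardized_fpc_score \<mu> l \<psi> y k =
    1 / sqrt (l k) * inner (\<psi> k) (x - y)"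
  by (simp add: standardized_fpc_score_def fpc_score_def inner_diff_left inner_diff_right
      inner_commute diff_divide_distrib)

lemma functional_mahalanobis_eq_scores:
  fixes \<psi> :: "nat \<Rightarrow> 'a::real_inner"
  assumes "\<And>j k. j \<in> {1..K} \<Longrightarrow> k \<in> {1..K} \<Longrightarrow> inner (\<psi> j) (\<psi> k) = (if j = k then 1 else 0)"
  shows "functional_mahalanobis l \<psi> K x y =
    sqrt (\<Sum>k=1..K. (standardized_fpc_score \<mu> l \<psi> x k - standardized_fpc_score \<mu> l \<psi> y k)\<^sup>2)"
proof -
  have "regularized_sqrt_inverse l \<psi> K (x - y) =
      (\<Sum>k=1..K. (1 / sqrt (l k) * inner (\<psi> k) (x - y)) *\<^sub>R \<psi> k)"
    by (simp add: regularized_sqrt_inverse_def tensor_square_def)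
  then show ?thesis
    unfolding functional_mahalanobis_def standardized_fpc_score_diff
    by (simp only: inner_orthonormal_sum[OF finite_atLeastAtMost assms])
qed

theorem proposition2p2:
  fixes M :: "'w measure" and a b :: real and \<chi>1 \<chi>2 :: "'w \<Rightarrow> L2"
    and \<mu> :: L2 and \<Gamma> :: "L2 \<Rightarrow> L2" and l :: "nat \<Rightarrow> real" and \<psi> :: "nat \<Rightarrow> L2" and K :: nat
  assumes "prob_space M" and "a < b"
    and "functional_random_variable M {a..b} \<chi>1" and "functional_random_variable M {a..b} \<chi>2"
    and "prob_space.indep_var M borel \<chi>1 borel \<chi>2"
    and "distr M borel \<chi>1 = distr M borel \<chi>2"
    and "mean_function M \<chi>1 = \<mu>" and "mean_function M \<chi>2 = \<mu>"
    and "covariance_operator M \<chi>1 = \<Gamma>" and "covariance_operator M \<chi>2 = \<Gamma>"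
    and "compact_operator_on (L2_on {a..b}) \<Gamma>"
    and "eigensystem (L2_on {a..b}) \<Gamma> l \<psi>"
    and "K \<ge> 1" and "l K > 0"
  shows "\<forall>\<omega>\<in>space M. functional_mahalanobis l \<psi> K (\<chi>1 \<omega>) (\<chi>2 \<omega>) =
    sqrt (\<Sum>k=1..K. (standardized_fpc_score \<mu> l \<psi> (\<chi>1 \<omega>) k
                   - standardized_fpc_score \<mu> l \<psi> (\<chi>2 \<omega>) k)\<^sup>2)"
proof -
  have "inner (\<psi> j) (\<psi> k) = (if j = k then 1 else 0)" if "j \<in> {1..K}" "k \<in> {1..K}" for j k
    using \<open>eigensystem (L2_on {a..b}) \<Gamma> l \<psi>\<close> that by (simp add: eigensystem_def)
  then show ?thesis
    by (blast intro: functional_mahalanobis_eq_scores)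
qed

end
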